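(* Let $(X,+)$ be a (not necessarily abelian) group and $f:X\to X$ a map. (a) Suppose $f$ is a bijective metahomomorphism or a bijective heap endomorphism of $(X,+)$, and let $(X,\triangleright_r)$ be the quandle $a\triangleright_r b:=a+f(b)-f(a)$. Define $a\bullet_r b:=b+f(a)$. Then $a\bullet_r b=b\bullet_r(b\triangleright_r a)$ for all $a,b\in X$, i.e. $(X,\bullet_r)$ is a Yang-Baxter algebra for $r_{\triangleright_r}$. (b) Suppose $f$ is a bijective metahomomorphism or a bijective heap endomorphism of $(X,+_{op})$, and let $(X,\triangleright_s)$ be the quandle $a\triangleright_s b:=-f(a)+f(b)+a$. Define $a\bullet_s b:=f(a)+b$. Then $a\bullet_s b=b\bullet_s(b\triangleright_s a)$ for all $a,b\in X$, i.e. $(X,\bullet_s)$ is a Yang-Baxter algebra for $r_{\triangleright_s}$.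
   Context: For a group $(X,+)$, $a+_{op}b:=b+a$. A map $f:X\to X$ is a heap endomorphism of $(X,+)$ if $f(a-b+c)=f(a)-f(b)+f(c)$ for all $a,b,c$; it is a metahomomorphism of $(X,+)$ if $f(a+b-f(a))=f(a)+f(b)-f^2(a)$ for all $a,b$ (with $f^2=f\circ f$). A quandle is a non-empty set with an operation $\triangleright$ such that $a\triangleright(b\triangleright c)=(a\triangleright b)\triangleright(a\triangleright c)$, $a\triangleright a=a$, and each $b\mapsto a\triangleright b$ is bijective. The solution of the set-theoretic braid equation associated to $(X,\triangleright)$ is $r_\triangleright(a,b)=(b,b\triangleright a)$. Given a solution $(X,r)$, $(X,m)$ with $m:X\times X\to X$ is a Yang-Baxter algebra for $r$ if $m(x,y)=m(r(x,y))$ for all $x,y\in X$. *)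

theory Defs
  imports "HOL-Algebra.Group"
begin

text \<open>
  Groups are not assumed abelian, so they are HOL-Algebra groups written multiplicatively:
  \<^term>\<open>a \<otimes>\<^bsub>G\<^esub> b\<close> stands for $a + b$ and \<^term>\<open>inv\<^bsub>G\<^esub> a\<close> for $-a$.
\<close>

definition opposite_group :: "('a, 'b) monoid_scheme \<Rightarrow> ('a, 'b) monoid_scheme" where
  "opposite_group G = G\<lparr>mult := \<lambda>a b. b \<otimes>\<^bsub>G\<^esub> a\<rparr>"

definition heap_endomorphism :: "('a, 'b) monoid_scheme \<Rightarrow> ('a \<Rightarrow> 'a) \<Rightarrow> bool" where
  "heap_endomorphism G f \<longleftrightarrow> f \<in> carrier G \<rightarrow> carrier G \<and>
     (\<forall>a\<in>carrier G. \<forall>b\<in>carrier G. \<forall>c\<in>carrier G.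
        f (a \<otimes>\<^bsub>G\<^esub> inv\<^bsub>G\<^esub> b \<otimes>\<^bsub>G\<^esub> c) = f a \<otimes>\<^bsub>G\<^esub> inv\<^bsub>G\<^esub> (f b) \<otimes>\<^bsub>G\<^esub> f c)"

definition metahomomorphism :: "('a, 'b) monoid_scheme \<Rightarrow> ('a \<Rightarrow> 'a) \<Rightarrow> bool" where
  "metahomomorphism G f \<longleftrightarrow> f \<in> carrier G \<rightarrow> carrier G \<and>
     (\<forall>a\<in>carrier G. \<forall>b\<in>carrier G.
        f (a \<otimes>\<^bsub>G\<^esub> b \<otimes>\<^bsub>G\<^esub> inv\<^bsub>G\<^esub> (f a)) = f a \<otimes>\<^bsub>G\<^esub> f b \<otimes>\<^bsub>G\<^esub> inv\<^bsub>G\<^esub> (f (f a)))"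

definition quandle :: "'a set \<Rightarrow> ('a \<Rightarrow> 'a \<Rightarrow> 'a) \<Rightarrow> bool" where
  "quandle X t \<longleftrightarrow> X \<noteq> {} \<and> t \<in> X \<rightarrow> X \<rightarrow> X \<and>
     (\<forall>a\<in>X. \<forall>b\<in>X. \<forall>c\<in>X. t a (t b c) = t (t a b) (t a c)) \<and>
     (\<forall>a\<in>X. t a a = a) \<and>
     (\<forall>a\<in>X. bij_betw (t a) X X)"

text \<open>The maps $r \times \mathrm{id}$ and $\mathrm{id} \times r$ on triples.\<close>

definition braid_left :: "('a \<times> 'a \<Rightarrow> 'a \<times> 'a) \<Rightarrow> 'a \<times> 'a \<times> 'a \<Rightarrow> 'a \<times> 'a \<times> 'a" where
  "braid_left r = (\<lambda>(x, y, z). let (u, v) = r (x, y) in (u, v, z))"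

definition braid_right :: "('a \<times> 'a \<Rightarrow> 'a \<times> 'a) \<Rightarrow> 'a \<times> 'a \<times> 'a \<Rightarrow> 'a \<times> 'a \<times> 'a" where
  "braid_right r = (\<lambda>(x, y, z). (x, r (y, z)))"

definition braid_solution :: "'a set \<Rightarrow> ('a \<times> 'a \<Rightarrow> 'a \<times> 'a) \<Rightarrow> bool" where
  "braid_solution X r \<longleftrightarrow> r \<in> X \<times> X \<rightarrow> X \<times> X \<and>
     (\<forall>p\<in>X \<times> X \<times> X.
        braid_left r (braid_right r (braid_left r p)) =
        braid_right r (braid_left r (braid_right r p)))"

definition quandle_solution :: "('a \<Rightarrow> 'a \<Rightarrow> 'a) \<Rightarrow> 'a \<times> 'a \<Rightarrow> 'a \<times> 'a" where
  "quandle_solution t = (\<lambda>(a, b). (b, t b a))"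

definition yang_baxter_algebra ::
    "'a set \<Rightarrow> ('a \<times> 'a \<Rightarrow> 'a \<times> 'a) \<Rightarrow> ('a \<Rightarrow> 'a \<Rightarrow> 'a) \<Rightarrow> bool" where
  "yang_baxter_algebra X r m \<longleftrightarrow> braid_solution X r \<and> m \<in> X \<rightarrow> X \<rightarrow> X \<and>
     (\<forall>x\<in>X. \<forall>y\<in>X. m x y = case_prod m (r (x, y)))"

definition tri_r :: "('a, 'b) monoid_scheme \<Rightarrow> ('a \<Rightarrow> 'a) \<Rightarrow> 'a \<Rightarrow> 'a \<Rightarrow> 'a" where
  "tri_r G f a b = a \<otimes>\<^bsub>G\<^esub> f b \<otimes>\<^bsub>G\<^esub> inv\<^bsub>G\<^esub> (f a)"

definition bullet_r :: "('a, 'b) monoid_scheme \<Rightarrow> ('a \<Rightarrow> 'a) \<Rightarrow> 'a \<Rightarrow> 'a \<Rightarrow> 'a" where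
  "bullet_r G f a b = b \<otimes>\<^bsub>G\<^esub> f a"

definition tri_s :: "('a, 'b) monoid_scheme \<Rightarrow> ('a \<Rightarrow> 'a) \<Rightarrow> 'a \<Rightarrow> 'a \<Rightarrow> 'a" where
  "tri_s G f a b = inv\<^bsub>G\<^esub> (f a) \<otimes>\<^bsub>G\<^esub> f b \<otimes>\<^bsub>G\<^esub> a"

definition bullet_s :: "('a, 'b) monoid_scheme \<Rightarrow> ('a \<Rightarrow> 'a) \<Rightarrow> 'a \<Rightarrow> 'a \<Rightarrow> 'a" where
  "bullet_s G f a b = f a \<otimes>\<^bsub>G\<^esub> b"

end

theory Submission
  imports Defs
begin

text \<open>
  Write the group additively. The bullet identity of part (a) is a cancellation:
  $b \bullet_r (b \triangleright_r a) = (b + f(a) - f(b)) + f(b) = b + f(a) = a \bullet_r b$.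
  The Yang-Baxter algebra property says exactly this for the solution $(a,b) \mapsto
  (b, b \triangleright a)$, which satisfies the braid equation because of left
  self-distributivity.

  What remains is that $\triangleright_r$ is a quandle. Idempotence is a cancellation, and
  bijectivity of $b \mapsto a \triangleright_r b$ comes from bijectivity of $f$. For
  self-distributivity, metahomomorphisms and heap endomorphisms enter through one common
  consequence: there is a constant $k$ with
  $f(a \triangleright_r b) = f(a) + k + f^2(b) - f^2(a) - k$ for all $a$, $b$. A metahomomorphism has $k = 0$ and a heap endomorphism has $k = -f(0)$.
  Substituting this into $(a \triangleright b) \triangleright (a \triangleright c)$, the inner terms
  $-f(a) + f(a)$, $-k + k$ and $-f^2(a) + f^2(a)$ cancel, and
  $a + f(b) + k + f^2(c) - f^2(b) - k - f(a)$ is left, which is also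
  $a \triangleright (b \triangleright c)$.

  Part (b) is part (a) for the opposite group, since there $\triangleright_r$ and $\bullet_r$
  become $\triangleright_s$ and $\bullet_s$.
\<close>

text \<open>
  Each side of the braid equation sends $(x, y, z)$ to a triple starting with
  $(z, z \triangleright y)$; the third entries are the two sides of self-distributivity.
\<close>

lemma quandle_solution_is_braid_solution:
  assumes "quandle X t"
  shows "braid_solution X (quandle_solution t)"
proof -
  have closed: "t a b \<in> X" if "a \<in> X" "b \<in> X" for a b
    using assms that unfolding quandle_def by blast
  have "t z (t y x) = t (t z y) (t z x)" if "x \<in> X" "y \<in> X" "z \<in> X" for x y z
    using assms that unfolding quandle_def by blast
  from this[symmetric] show ?thesis
    by (simp add: braid_solution_def quandle_solution_def braid_left_def braid_right_def
        closed Pi_iff)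
qed

lemma yang_baxter_algebra_quandle_solutionI:
  assumes "quandle X t" and "m \<in> X \<rightarrow> X \<rightarrow> X"
    and "\<And>a b. a \<in> X \<Longrightarrow> b \<in> X \<Longrightarrow> m a b = m b (t b a)"
  shows "yang_baxter_algebra X (quandle_solution t) m"
  unfolding yang_baxter_algebra_def
proof (intro conjI ballI)
  show "m a b = case_prod m (quandle_solution t (a, b))" if "a \<in> X" "b \<in> X" for a b
    unfolding quandle_solution_def by (simp add: assms(3)[OF that, symmetric])
qed (rule quandle_solution_is_braid_solution[OF assms(1)], rule assms(2))

context group
begin

lemma inv_mult_cancel_left:
  assumes "x \<in> carrier G" and "y \<in> carrier G"
  shows "inv x \<otimes> (x \<otimes> y) = y" and "x \<otimes> (inv x \<otimes> y) = y"
  using assms by (simp_all add: m_assoc[symmetric])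

text \<open>
  This is the defining identity of a metahomomorphism at $a$ and $f(b)$, with the constant
  $k = 0$ kept visible so that it has the form required in the proof of self-distributivity.
\<close>

lemma metahomomorphism_tri_r:
  assumes "metahomomorphism G f" and "a \<in> carrier G" and "b \<in> carrier G"
  shows "f (tri_r G f a b) = f a \<otimes> \<one> \<otimes> f (f b) \<otimes> inv (f (f a)) \<otimes> inv \<one>"
  using assms by (auto simp: metahomomorphism_def tri_r_def Pi_iff)

text \<open>
  A heap endomorphism is a homomorphism up to translation by $f(0)$: the identity
  $f(a - b + c) = f(a) - f(b) + f(c)$ gives $f(x + y) = f(x) - f(0) + f(y)$ for $b = 0$, and
  $f(-y) = f(0) - f(y) + f(0)$ for $a = c = 0$.
\<close>

lemma heap_endomorphism_tri_r:
  assumes heap: "heap_endomorphism G f" and a: "a \<in> carrier G" and b: "b \<in> carrier G"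
  shows "f (tri_r G f a b) =
    f a \<otimes> inv (f \<one>) \<otimes> f (f b) \<otimes> inv (f (f a)) \<otimes> inv (inv (f \<one>))"
proof -
  have cl: "f x \<in> carrier G" if "x \<in> carrier G" for x
    using heap that by (auto simp: heap_endomorphism_def)
  have heap_eq: "f (x \<otimes> inv y \<otimes> z) = f x \<otimes> inv (f y) \<otimes> f z"
    if "x \<in> carrier G" "y \<in> carrier G" "z \<in> carrier G" for x y z
    using heap that by (simp add: heap_endomorphism_def)
  have f_mult: "f (x \<otimes> y) = f x \<otimes> inv (f \<one>) \<otimes> f y"
    if "x \<in> carrier G" "y \<in> carrier G" for x y
    using heap_eq[of x \<one> y] that by simp
  have f_inv: "f (inv y) = f \<one> \<otimes> inv (f y) \<otimes> f \<one>" if "y \<in> carrier G" for y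
    using heap_eq[of \<one> y \<one>] that by simp
  have "f (tri_r G f a b) = f a \<otimes> inv (f \<one>) \<otimes> f (f b) \<otimes> inv (f \<one>) \<otimes> f (inv (f a))"
    using a b cl by (simp add: tri_r_def f_mult)
  also have "\<dots> = f a \<otimes> inv (f \<one>) \<otimes> f (f b) \<otimes> inv (f (f a)) \<otimes> f \<one>"
    using a b cl by (simp add: f_inv m_assoc inv_mult_cancel_left)
  finally show ?thesis using cl by simp
qed

lemma bij_betw_tri_r:
  assumes bij: "bij_betw f (carrier G) (carrier G)" and a: "a \<in> carrier G"
  shows "bij_betw (tri_r G f a) (carrier G) (carrier G)"
proof -
  have fa: "f a \<in> carrier G" using bij a by (auto simp: bij_betw_def)
  have "bij_betw (\<lambda>x. a \<otimes> x \<otimes> inv (f a)) (carrier G) (carrier G)"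
    by (rule bij_betw_byWitness[where f' = "\<lambda>y. inv a \<otimes> y \<otimes> f a"])
      (use a fa in \<open>auto simp: m_assoc inv_mult_cancel_left\<close>)
  from bij_betw_trans[OF bij this] show ?thesis
    by (simp add: comp_def tri_r_def[abs_def])
qed

text \<open>
  The operation \<^term>\<open>t\<close> is only required to agree with $\triangleright_r$ on the carrier:
  $\triangleright_s$ coincides with the $\triangleright_r$ of the opposite group by associativity,
  hence not outside the carrier.
\<close>

lemma quandle_tri_r:
  assumes bij: "bij_betw f (carrier G) (carrier G)" and k: "k \<in> carrier G"
    and f_tri: "\<And>a b. a \<in> carrier G \<Longrightarrow> b \<in> carrier G \<Longrightarrow>
      f (tri_r G f a b) = f a \<otimes> k \<otimes> f (f b) \<otimes> inv (f (f a)) \<otimes> inv k"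
    and t: "\<And>a b. a \<in> carrier G \<Longrightarrow> b \<in> carrier G \<Longrightarrow> t a b = tri_r G f a b"
  shows "quandle (carrier G) t"
proof -
  have cl: "f x \<in> carrier G" if "x \<in> carrier G" for x
    using bij that by (auto simp: bij_betw_def)
  have tri_closed: "tri_r G f a b \<in> carrier G" if "a \<in> carrier G" "b \<in> carrier G" for a b
    using that cl by (simp add: tri_r_def)
  have distrib: "tri_r G f a (tri_r G f b c) = tri_r G f (tri_r G f a b) (tri_r G f a c)"
    if a: "a \<in> carrier G" and b: "b \<in> carrier G" and c: "c \<in> carrier G" for a b c
  proof -
    have "tri_r G f a (tri_r G f b c) =
        a \<otimes> (f b \<otimes> k \<otimes> f (f c) \<otimes> inv (f (f b)) \<otimes> inv k) \<otimes> inv (f a)"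
      using b c by (simp add: tri_r_def[of G f a] f_tri)
    also have "\<dots> = (a \<otimes> f b \<otimes> inv (f a)) \<otimes>
        (f a \<otimes> k \<otimes> f (f c) \<otimes> inv (f (f a)) \<otimes> inv k) \<otimes>
        inv (f a \<otimes> k \<otimes> f (f b) \<otimes> inv (f (f a)) \<otimes> inv k)"
      using a b c k cl by (simp add: m_assoc inv_mult_group inv_mult_cancel_left)
    also have "\<dots> = tri_r G f (tri_r G f a b) (tri_r G f a c)"
      using a b c by (simp add: tri_r_def[of G f "tri_r G f a b"] f_tri) (simp add: tri_r_def)
    finally show ?thesis .
  qed
  have idem: "tri_r G f a a = a" if "a \<in> carrier G" for a
    using that cl by (simp add: tri_r_def m_assoc)
  have bij_t: "bij_betw (t a) (carrier G) (carrier G)" if "a \<in> carrier G" for a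
    using bij_betw_tri_r[OF bij that] bij_betw_cong[of "carrier G" "t a"] t that by blast
  have "carrier G \<noteq> {}" by blast
  then show ?thesis
    unfolding quandle_def
  proof (intro conjI ballI)
    show "t a (t b c) = t (t a b) (t a c)"
      if "a \<in> carrier G" "b \<in> carrier G" "c \<in> carrier G" for a b c
      using distrib[OF that] by (simp add: t tri_closed that)
  qed (simp_all add: t tri_closed idem bij_t)
qed

lemma bullet_r_tri_r:
  assumes "f \<in> carrier G \<rightarrow> carrier G" and "a \<in> carrier G" and "b \<in> carrier G"
  shows "bullet_r G f a b = bullet_r G f b (tri_r G f b a)"
  using assms by (simp add: bullet_r_def tri_r_def m_assoc Pi_iff)

lemma yang_baxter_algebra_bullet_r:
  assumes bij: "bij_betw f (carrier G) (carrier G)"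
    and f: "metahomomorphism G f \<or> heap_endomorphism G f"
    and t: "\<And>a b. a \<in> carrier G \<Longrightarrow> b \<in> carrier G \<Longrightarrow> t a b = tri_r G f a b"
  shows "quandle (carrier G) t \<and>
    (\<forall>a\<in>carrier G. \<forall>b\<in>carrier G. bullet_r G f a b = bullet_r G f b (t b a)) \<and>
    yang_baxter_algebra (carrier G) (quandle_solution t) (bullet_r G f)"
proof -
  have cl: "f \<in> carrier G \<rightarrow> carrier G"
    using bij by (rule bij_betw_imp_funcset)
  have quandle: "quandle (carrier G) t"
    using f
  proof
    assume "metahomomorphism G f"
    then show ?thesis
      by (intro quandle_tri_r[OF bij one_closed] metahomomorphism_tri_r t)
  next
    assume "heap_endomorphism G f"
    moreover have "inv (f \<one>) \<in> carrier G" using cl by auto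
    ultimately show ?thesis
      by (intro quandle_tri_r[OF bij, of "inv (f \<one>)"] heap_endomorphism_tri_r t)
  qed
  have eq: "bullet_r G f a b = bullet_r G f b (t b a)"
    if "a \<in> carrier G" "b \<in> carrier G" for a b
    using bullet_r_tri_r[OF cl that] t that by simp
  have "bullet_r G f \<in> carrier G \<rightarrow> carrier G \<rightarrow> carrier G"
    using cl by (auto simp: bullet_r_def Pi_iff)
  from yang_baxter_algebra_quandle_solutionI[OF quandle this eq] quandle eq
  show ?thesis by blast
qed

end

lemma carrier_opposite_group [simp]: "carrier (opposite_group G) = carrier G"
  and one_opposite_group [simp]: "\<one>\<^bsub>opposite_group G\<^esub> = \<one>\<^bsub>G\<^esub>"
  and mult_opposite_group [simp]: "a \<otimes>\<^bsub>opposite_group G\<^esub> b = b \<otimes>\<^bsub>G\<^esub> a"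
  by (simp_all add: opposite_group_def)

text \<open>
  The inverse is defined by a two-sided condition, so exchanging the factors does not change it.
\<close>

lemma m_inv_opposite_group [simp]: "inv\<^bsub>opposite_group G\<^esub> a = inv\<^bsub>G\<^esub> a"
  by (simp add: m_inv_def conj_commute)

lemma group_opposite_group:
  assumes "group G"
  shows "group (opposite_group G)"
proof -
  interpret group G by fact
  show ?thesis
  proof (rule groupI)
    show "\<exists>y\<in>carrier (opposite_group G). y \<otimes>\<^bsub>opposite_group G\<^esub> x = \<one>\<^bsub>opposite_group G\<^esub>"
      if "x \<in> carrier (opposite_group G)" for x
      using that by (intro bexI[of _ "inv\<^bsub>G\<^esub> x"]) simp_all
  qed (simp_all add: m_assoc)
qed

lemma tri_s_eq_tri_r_opposite_group:
  assumes "group G" and "f \<in> carrier G \<rightarrow> carrier G"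
    and "a \<in> carrier G" and "b \<in> carrier G"
  shows "tri_s G f a b = tri_r (opposite_group G) f a b"
proof -
  interpret group G by fact
  show ?thesis using assms by (simp add: tri_s_def tri_r_def m_assoc Pi_iff)
qed

lemma bullet_s_eq_bullet_r_opposite_group:
  "bullet_s G f = bullet_r (opposite_group G) f"
  by (simp add: bullet_s_def bullet_r_def fun_eq_iff)

theorem lemma3p20:
  fixes G :: "('a, 'b) monoid_scheme" and f :: "'a \<Rightarrow> 'a"
  assumes "group G"
    and "f \<in> carrier G \<rightarrow> carrier G"
  shows
    "(bij_betw f (carrier G) (carrier G) \<and> (metahomomorphism G f \<or> heap_endomorphism G f) \<longrightarrow>
        quandle (carrier G) (tri_r G f) \<and>
        (\<forall>a\<in>carrier G. \<forall>b\<in>carrier G.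
           bullet_r G f a b = bullet_r G f b (tri_r G f b a)) \<and>
        yang_baxter_algebra (carrier G) (quandle_solution (tri_r G f)) (bullet_r G f)) \<and>
     (bij_betw f (carrier G) (carrier G) \<and>
      (metahomomorphism (opposite_group G) f \<or> heap_endomorphism (opposite_group G) f) \<longrightarrow>
        quandle (carrier G) (tri_s G f) \<and>
        (\<forall>a\<in>carrier G. \<forall>b\<in>carrier G.
           bullet_s G f a b = bullet_s G f b (tri_s G f b a)) \<and>
        yang_baxter_algebra (carrier G) (quandle_solution (tri_s G f)) (bullet_s G f))"
proof (intro conjI[of "_ \<longrightarrow> _"] impI; elim conjE)
  assume "bij_betw f (carrier G) (carrier G)" "metahomomorphism G f \<or> heap_endomorphism G f"
  then show "quandle (carrier G) (tri_r G f) \<and>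
        (\<forall>a\<in>carrier G. \<forall>b\<in>carrier G.
           bullet_r G f a b = bullet_r G f b (tri_r G f b a)) \<and>
        yang_baxter_algebra (carrier G) (quandle_solution (tri_r G f)) (bullet_r G f)"
    by (rule group.yang_baxter_algebra_bullet_r[OF assms(1)]) (rule refl)
next
  assume bij: "bij_betw f (carrier G) (carrier G)"
    and f: "metahomomorphism (opposite_group G) f \<or> heap_endomorphism (opposite_group G) f"
  from group.yang_baxter_algebra_bullet_r[OF group_opposite_group[OF assms(1)] _ f,
      of "tri_s G f"] bij
  show "quandle (carrier G) (tri_s G f) \<and>
        (\<forall>a\<in>carrier G. \<forall>b\<in>carrier G.
           bullet_s G f a b = bullet_s G f b (tri_s G f b a)) \<and>
        yang_baxter_algebra (carrier G) (quandle_solution (tri_s G f)) (bullet_s G f)"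
    by (simp add: bullet_s_eq_bullet_r_opposite_group tri_s_eq_tri_r_opposite_group[OF assms])
qed

end
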